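(* Let $m\ge 2$ be a natural number. The number $t_m^+$ of sparse vip $m$-types is bounded above by $$t_m^+\le t_m\,(m-1)!\prod_{i<m-1}(i!)^2,$$ where $t_m$ is the $m$-th tangent number.
   Context: The tangent numbers are defined by $\tan(x)=\sum_{n=1}^{\infty} t_n\frac{x^{2n-1}}{(2n-1)!}$, equivalently $t_1=1$ and $t_n=\sum_{i=1}^{n-1}\binom{2n-2}{2i-1}t_it_{n-i}$ for $n\ge 2$. ${}^{n\ge}2$ is the set of $0$-$1$ sequences of length $\le n$; $\lg(s)$ is the length of $s$, $\subseteq$ is end-extension, $s\wedge t$ (the meet) is the longest common initial segment of $s$ and $t$. The meet closure of $A$ is $A^{\wedge}=\{s\wedge t: s,t\in A\}\supseteq A$. A set of sequences is transverse if distinct elements have different lengths. $A$ is diagonal if it is an antichain (pairwise $\subseteq$-incomparable) and $A^\wedge$ is transverse. $A$ is sparse if for all $t\in A$ and $s\in A^\wedge\setminus\{t\}$: $\lg(s)<\lg(t)$ and $t(\lg(s))=1$ imply $s\subseteq t$. For a tree $T$ of sequences closed under initial segments, $T(\alpha)$ is the set of its nodes of length $\alpha$. A well-ordering of the levels of $T$ is a linear order of $T$ extending the length order ($\lg(s)<\lg(t)$ implies $s\prec t$) that well-orders each level. For a sparse diagonal set $D$, a $D$-vip order on $T$ is a well-ordering $\prec$ of the levels of $T$ such that for every $d\in D^\wedge$, $d$ is the $\prec$-least element of $T(\lg(d))$, and for all $u,v\in T(\lg(d))\setminus\{d\}$, if $d\wedge u\subsetneq d\wedge v\neq d$ then $u\prec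 v$ (the paper's general definition has one more clause, which is vacuous when $D$ is sparse). A sparse $m$-type is a subtree $\tau$ of ${}^{2m-2\ge}2$, closed under initial segments, whose set $L$ of leaves is an $m$-element sparse diagonal set. A sparse vip $m$-type is a pair $(\tau,\lessdot)$ where $\tau$ is a sparse $m$-type with leaf set $L$ and $\lessdot$ is an $L$-vip order on $\tau$. *)

theory Defs
  imports "HOL-Analysis.Analysis" "HOL-Library.Sublist"
begin

text \<open>
  \<open>tan x = (\<Sum>n\<ge>1. t\<^sub>n * x ^ (2 * n - 1) / fact (2 * n - 1))\<close>. The series \<^term>\<open>fps_tan 1\<close> is
  the Taylor expansion of the tangent function at 0 by \<open>has_fps_expansion_tan'\<close>.
\<close>

definition tangent_number :: "nat \<Rightarrow> real" where
  "tangent_number n = fps_nth (fps_tan 1) (2 * n - 1) * fact (2 * n - 1)"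

text \<open>
  Finite 0-1 sequences are boolean lists (\<open>True\<close> is 1, \<open>False\<close> is 0), with \<^const>\<open>prefix\<close> as
  end-extension and \<^const>\<open>longest_common_prefix\<close> as meet.
\<close>

type_synonym bseq = "bool list"

definition meet_closure :: "bseq set \<Rightarrow> bseq set" where
  "meet_closure A = {longest_common_prefix s t | s t. s \<in> A \<and> t \<in> A}"

definition transverse :: "bseq set \<Rightarrow> bool" where
  "transverse A \<longleftrightarrow> (\<forall>s\<in>A. \<forall>t\<in>A. s \<noteq> t \<longrightarrow> length s \<noteq> length t)"

definition diagonal_set :: "bseq set \<Rightarrow> bool" where
  "diagonal_set A \<longleftrightarrow>
     (\<forall>s\<in>A. \<forall>t\<in>A. s \<noteq> t \<longrightarrow> \<not> prefix s t \<and> \<not> prefix t s) \<and> transverse (meet_closure A)"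

definition sparse_set :: "bseq set \<Rightarrow> bool" where
  "sparse_set A \<longleftrightarrow>
     (\<forall>t\<in>A. \<forall>s\<in>meet_closure A - {t}.
        length s < length t \<and> t ! length s = True \<longrightarrow> prefix s t)"

definition level :: "bseq set \<Rightarrow> nat \<Rightarrow> bseq set" where
  "level T n = {t \<in> T. length t = n}"

definition prefix_closed :: "bseq set \<Rightarrow> bool" where
  "prefix_closed T \<longleftrightarrow> (\<forall>t\<in>T. \<forall>s. prefix s t \<longrightarrow> s \<in> T)"

definition leaves :: "bseq set \<Rightarrow> bseq set" where
  "leaves T = {t \<in> T. \<not> (\<exists>s\<in>T. strict_prefix t s)}"

text \<open>
  Orders are strict: \<open>(s, t) \<in> r\<close> means \<open>s \<prec> t\<close>. Requiring \<open>r \<subseteq> T \<times> T\<close> makes each order on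
  \<open>T\<close> correspond to exactly one relation, which matters for counting. A strict linear order is a
  well-order on a level iff its restriction to that level is well-founded.
\<close>

definition level_well_ordering :: "bseq set \<Rightarrow> bseq rel \<Rightarrow> bool" where
  "level_well_ordering T r \<longleftrightarrow>
     r \<subseteq> T \<times> T \<and> strict_linear_order_on T r \<and>
     (\<forall>s\<in>T. \<forall>t\<in>T. length s < length t \<longrightarrow> (s, t) \<in> r) \<and>
     (\<forall>n. wf (Restr r (level T n)))"

text \<open>
  This is the notion for sparse diagonal \<open>D\<close> only: for other \<open>D\<close> the definition of a vip order has
  a further clause, which is vacuous when \<open>D\<close> is sparse.
\<close>

definition vip_order :: "bseq set \<Rightarrow> bseq set \<Rightarrow> bseq rel \<Rightarrow> bool" where
  "vip_order D T r \<longleftrightarrow>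
     level_well_ordering T r \<and>
     (\<forall>d\<in>meet_closure D.
        d \<in> level T (length d) \<and>
        (\<forall>u\<in>level T (length d) - {d}. (d, u) \<in> r) \<and>
        (\<forall>u\<in>level T (length d) - {d}. \<forall>v\<in>level T (length d) - {d}.
           strict_prefix (longest_common_prefix d u) (longest_common_prefix d v) \<and>
           longest_common_prefix d v \<noteq> d \<longrightarrow> (u, v) \<in> r))"

definition sparse_type :: "nat \<Rightarrow> bseq set \<Rightarrow> bool" where
  "sparse_type m T \<longleftrightarrow>
     T \<subseteq> {s. length s \<le> 2 * m - 2} \<and> prefix_closed T \<and>
     finite (leaves T) \<and> card (leaves T) = m \<and>
     diagonal_set (leaves T) \<and> sparse_set (leaves T)"

definition sparse_vip_types :: "nat \<Rightarrow> (bseq set \<times> bseq rel) set" where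
  "sparse_vip_types m = {(T, r). sparse_type m T \<and> vip_order (leaves T) T r}"

text \<open>Hence \<^const>\<open>card\<close> does count the sparse vip \<open>m\<close>-types.\<close>

lemma finite_sparse_vip_types: "finite (sparse_vip_types m)"
proof -
  let ?S = "{s :: bseq. length s \<le> 2 * m - 2}"
  have "finite ?S"
    using finite_lists_length_le[of "UNIV :: bool set" "2 * m - 2"] by simp
  then have "finite (Pow ?S \<times> Pow (?S \<times> ?S))"
    by simp
  moreover have "sparse_vip_types m \<subseteq> Pow ?S \<times> Pow (?S \<times> ?S)"
    unfolding sparse_vip_types_def sparse_type_def vip_order_def level_well_ordering_def
    by blast
  ultimately show ?thesis
    by (rule rev_finite_subset)
qed

end

theory Submission
  imports Defs
begin

text \<open>
  There are at most \<open>t\<^sub>m\<close> sparse \<open>m\<close>-types, and each of them carries at most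
  \<open>(m - 1)! * (\<Prod>i<m - 1. (i!)\<^sup>2)\<close> vip orders; the bound is the product of the two.

  Both estimates start from the fact that the meet closure of an antichain of \<open>m\<close> sequences has
  \<open>2 * m - 1\<close> elements, namely the leaves and the branching nodes of a full binary tree
  (\<open>card_meet_closure\<close>). In an \<open>m\<close>-type they have distinct lengths among the \<open>2 * m - 1\<close> numbers
  \<open>0, \<dots>, 2 * m - 2\<close>, so every level contains exactly one of them.

  A type is the set of initial segments of its leaves, so it suffices to count the leaf sets. By
  sparseness, a leaf can take the value 1 only directly above one of its own initial segments in
  the meet closure, hence a leaf set is determined by the way in which the levels are shared
  out at its branching nodes: the lowest level is used by the root, and the others are divided
  between the part of the tree above the left successor of the root and the part above the right
  one. If \<open>a n\<close>
  bounds the number of leaf sets that use a given set of \<open>n\<close> levels, this yields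
  \<open>a (n + 1) = (\<Sum>k\<le>n. (n choose k) * a k * a (n - k))\<close>, with one more for \<open>n = 0\<close>, where the root
  may itself be a leaf. This is the recursion \<open>tan' = 1 + tan\<^sup>2\<close> for the derivatives of \<open>tan\<close> at 0
  (\<open>card_sparse_diagonals_le\<close>).

  A vip order is determined by its restrictions to the levels, and on a level of \<open>k\<close> nodes, the
  least of which is prescribed, there are at most \<open>(k - 1)!\<close> of them. As each level has at most
  one leaf or branching node, consecutive levels differ by at most one in size. Since the levels
  \<open>0\<close> and \<open>2 * m - 2\<close> have one node, level \<open>n\<close> has at most \<open>min n (2 * m - 2 - n) + 1\<close>. The factors
  \<open>i!\<close> with \<open>i < m - 1\<close> then occur twice, on the way up and on the way down, and \<open>(m - 1)!\<close> once, in
  the middle (\<open>card_vip_orders_le\<close>, \<open>prod_fold_in_half\<close>).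
\<close>

section \<open>Splitting an antichain at its root\<close>

lemma longest_common_prefix_append:
  "longest_common_prefix (p @ xs) (p @ ys) = p @ longest_common_prefix xs ys"
  by (induction p) auto

lemma longest_common_prefix_self [simp]: "longest_common_prefix s s = s"
  by (induction s) auto

lemma longest_common_prefix_diverge:
  assumes "a \<noteq> b" "prefix (p @ [a]) s" "prefix (p @ [b]) t"
  shows "longest_common_prefix s t = p"
  using assms by (auto simp: prefix_def longest_common_prefix_append)

lemma subset_meet_closure: "L \<subseteq> meet_closure L"
  unfolding meet_closure_def by (metis (mono_tags, lifting) longest_common_prefix_self mem_Collect_eq subsetI)

lemma meet_closure_mono: "A \<subseteq> B \<Longrightarrow> meet_closure A \<subseteq> meet_closure B"
  unfolding meet_closure_def by blast

lemma meet_closure_singleton [simp]: "meet_closure {t} = {t}"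
  unfolding meet_closure_def by simp

lemma finite_meet_closure:
  assumes "finite L"
  shows "finite (meet_closure L)"
proof -
  have "meet_closure L = (\<lambda>(s, t). longest_common_prefix s t) ` (L \<times> L)"
    unfolding meet_closure_def by auto
  then show ?thesis
    using assms by simp
qed

lemma prefix_meet_closure:
  assumes "\<And>t. t \<in> L \<Longrightarrow> prefix q t" "s \<in> meet_closure L"
  shows "prefix q s"
  using assms unfolding meet_closure_def by (auto intro: longest_common_prefix_max_prefix)

definition prefix_antichain :: "bseq set \<Rightarrow> bool" where
  "prefix_antichain L \<longleftrightarrow> (\<forall>s\<in>L. \<forall>t\<in>L. prefix s t \<longrightarrow> s = t)"

definition above :: "bseq \<Rightarrow> bseq set \<Rightarrow> bseq set" where
  "above q L = {t \<in> L. prefix q t}"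

lemma above_subset: "above q L \<subseteq> L"
  unfolding above_def by blast

lemma prefix_meet_closure_above: "s \<in> meet_closure (above q L) \<Longrightarrow> prefix q s"
  by (rule prefix_meet_closure[of "above q L"]) (auto simp: above_def)

lemma prefix_snoc_unique:
  "prefix (p @ [a]) s \<Longrightarrow> prefix (p @ [b]) s \<Longrightarrow> a = b"
  by (auto simp: prefix_def)

lemma prefix_antichain_subset: "prefix_antichain B \<Longrightarrow> A \<subseteq> B \<Longrightarrow> prefix_antichain A"
  unfolding prefix_antichain_def by blast

text \<open>
  The longest common initial segment \<open>p\<close> of \<open>L\<close> is the root of the tree. It is not in \<open>L\<close>, as it
  would be an initial segment of another element; and both successors of \<open>p\<close> are used, as \<open>p\<close>
  would not be the longest otherwise.
\<close>

lemma antichain_branches: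
  assumes "prefix_antichain L" "s \<in> L" "t \<in> L" "s \<noteq> t"
  obtains p where "\<And>u. u \<in> L \<Longrightarrow> \<exists>b. prefix (p @ [b]) u"
    and "\<And>b. above (p @ [b]) L \<noteq> {}"
proof
  let ?p = "Longest_common_prefix L"
  show snoc: "\<exists>b. prefix (?p @ [b]) u" if "u \<in> L" for u
  proof -
    have "prefix ?p u"
      using that by (rule Longest_common_prefix_prefix)
    moreover have "?p \<noteq> u"
    proof
      assume "?p = u"
      then have "u = v" if "v \<in> L" for v
        using assms(1) \<open>u \<in> L\<close> that Longest_common_prefix_prefix[OF that]
        unfolding prefix_antichain_def by simp
      then show False
        using assms(2-4) by metis
    qed
    ultimately obtain b zs where "u = ?p @ b # zs"
      by (metis append_Nil2 neq_Nil_conv prefix_def)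
    then have "prefix (?p @ [b]) u"
      by simp
    then show ?thesis ..
  qed
  show "above (?p @ [b]) L \<noteq> {}" for b
  proof
    assume empty: "above (?p @ [b]) L = {}"
    have "prefix (?p @ [\<not> b]) u" if "u \<in> L" for u
    proof -
      obtain c where "prefix (?p @ [c]) u"
        using snoc \<open>u \<in> L\<close> by blast
      moreover from this have "c = (\<not> b)"
        using empty \<open>u \<in> L\<close> unfolding above_def by (cases b; cases c) auto
      ultimately show ?thesis
        by simp
    qed
    then have "length (?p @ [\<not> b]) \<le> length ?p"
      using assms(2) by (intro Longest_common_prefix_longest) auto
    then show False
      by simp
  qed
qed

lemma Un_above:
  assumes "\<And>u. u \<in> L \<Longrightarrow> \<exists>b. prefix (p @ [b]) u"
  shows "L = above (p @ [False]) L \<union> above (p @ [True]) L"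
proof
  show "L \<subseteq> above (p @ [False]) L \<union> above (p @ [True]) L"
  proof
    fix u assume "u \<in> L"
    moreover from this obtain b where "prefix (p @ [b]) u"
      using assms by blast
    ultimately show "u \<in> above (p @ [False]) L \<union> above (p @ [True]) L"
      unfolding above_def by (cases b) auto
  qed
qed (auto simp: above_def)

text \<open>
  Two sequences on the same side of the root meet on that side, and two sequences on different
  sides meet in the root. By \<open>meet_closure_above_disjoint\<close> the three parts are disjoint.
\<close>

lemma meet_closure_branches:
  assumes snoc: "\<And>u. u \<in> L \<Longrightarrow> \<exists>b. prefix (p @ [b]) u"
    and ne: "\<And>b. above (p @ [b]) L \<noteq> {}"
  shows "meet_closure L =
    insert p (meet_closure (above (p @ [False]) L) \<union> meet_closure (above (p @ [True]) L))"
    (is "_ = ?R")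
proof
  show "meet_closure L \<subseteq> ?R"
  proof
    fix x assume "x \<in> meet_closure L"
    then obtain s t where st: "s \<in> L" "t \<in> L" "x = longest_common_prefix s t"
      unfolding meet_closure_def by blast
    obtain a b where ab: "prefix (p @ [a]) s" "prefix (p @ [b]) t"
      using snoc st by blast
    show "x \<in> ?R"
    proof (cases "a = b")
      case True
      then have "x \<in> meet_closure (above (p @ [a]) L)"
        using st ab unfolding meet_closure_def above_def by blast
      then show ?thesis
        by (cases a) auto
    next
      case False
      then show ?thesis
        using st(3) longest_common_prefix_diverge[OF False ab] by simp
    qed
  qed
  obtain s t where "s \<in> above (p @ [False]) L" "t \<in> above (p @ [True]) L"
    using ne by blast
  then have "p = longest_common_prefix s t" "s \<in> L" "t \<in> L"
    using longest_common_prefix_diverge[of False True p s t] unfolding above_def by auto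
  then have "p \<in> meet_closure L"
    unfolding meet_closure_def by blast
  then show "?R \<subseteq> meet_closure L"
    using meet_closure_mono[OF above_subset] by blast
qed

lemma meet_closure_above_disjoint:
  "meet_closure (above (p @ [False]) L) \<inter> meet_closure (above (p @ [True]) L) = {}"
  "p \<notin> meet_closure (above (p @ [b]) L)"
proof -
  show "meet_closure (above (p @ [False]) L) \<inter> meet_closure (above (p @ [True]) L) = {}"
    using prefix_meet_closure_above[of _ "p @ [False]" L]
      prefix_meet_closure_above[of _ "p @ [True]" L] prefix_snoc_unique[of p False _ True]
    by auto
  show "p \<notin> meet_closure (above (p @ [b]) L)"
    using prefix_meet_closure_above[of p "p @ [b]" L] by auto
qed

text \<open>
  A full binary tree with \<open>m\<close> leaves has \<open>m - 1\<close> inner nodes; the induction removes the root.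
\<close>

lemma card_meet_closure:
  assumes "finite L" "L \<noteq> {}" "prefix_antichain L"
  shows "card (meet_closure L) + 1 = 2 * card L"
  using assms
proof (induction "card L" arbitrary: L rule: less_induct)
  case less
  show ?case
  proof (cases "\<exists>t. L = {t}")
    case True
    then show ?thesis
      by auto
  next
    case False
    then obtain s t where "s \<in> L" "t \<in> L" "s \<noteq> t"
      using less.prems(2) by (metis is_singletonI' is_singleton_def)
    then obtain p where snoc: "\<And>u. u \<in> L \<Longrightarrow> \<exists>b. prefix (p @ [b]) u"
      and ne: "\<And>b. above (p @ [b]) L \<noteq> {}"
      using antichain_branches less.prems(3) by metis
    let ?L = "\<lambda>b. above (p @ [b]) L"
    have fin: "finite (?L b)" for b
      using less.prems(1) above_subset finite_subset by blast
    have "?L False \<inter> ?L True = {}"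
      using prefix_snoc_unique[of p False _ True] unfolding above_def by auto
    then have card: "card L = card (?L False) + card (?L True)"
      using Un_above[OF snoc] card_Un_disjoint[OF fin fin] by metis
    have pos: "card (?L b) > 0" for b
      using fin ne by (simp add: card_gt_0_iff)
    have "card (?L b) < card L" for b
      using card pos[of False] pos[of True] by (cases b) auto
    then have IH: "card (meet_closure (?L b)) + 1 = 2 * card (?L b)" for b
      by (intro less.hyps fin ne prefix_antichain_subset[OF less.prems(3) above_subset])
    have "card (meet_closure L) =
        1 + (card (meet_closure (?L False)) + card (meet_closure (?L True)))"
      using meet_closure_above_disjoint[where p = p and L = L] fin
      by (subst meet_closure_branches[OF snoc ne])
        (simp_all add: finite_meet_closure card_Un_disjoint)
    then show ?thesis
      using IH[of False] IH[of True] card by simp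
  qed
qed

section \<open>Sparse diagonal sets are counted by the tangent function\<close>

lemma fps_tan_deriv_eq: "fps_deriv (fps_tan (1::real)) = 1 + (fps_tan 1)\<^sup>2"
proof -
  have "fps_cos (1::real) \<noteq> 0"
    by (metis fps_cos_nth_0 fps_zero_nth zero_neq_one)
  have cos: "fps_nth ((fps_cos (1::real))\<^sup>2) 0 \<noteq> 0"
    by (simp add: power2_eq_square)
  have "(fps_tan (1::real))\<^sup>2 * (fps_cos 1)\<^sup>2 = (fps_sin 1)\<^sup>2"
    by (simp add: fps_tan_def power_mult_distrib[symmetric] fps_divide_unit
        mult.assoc inverse_mult_eq_1)
  then have "(1 + (fps_tan (1::real))\<^sup>2) * (fps_cos 1)\<^sup>2 = 1"
    using fps_sin_cos_sum_of_squares[of "1::real"] by (simp add: distrib_right)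
  then have "1 / (fps_cos (1::real))\<^sup>2 = 1 + (fps_tan 1)\<^sup>2"
    using cos by (metis fps_divide_times_eq fps_zero_nth nonzero_mult_div_cancel_right)
  then show ?thesis
    by (simp add: fps_tan_deriv)
qed

text \<open>
  The \<open>n\<close>-th derivative of the tangent function at 0: the tangent numbers at odd \<open>n\<close> and 0 at even
  \<open>n\<close>. Including the zeros makes the recursion run over all subsets of the levels instead of those
  of odd size only.
\<close>

definition tan_coeff :: "nat \<Rightarrow> real" where
  "tan_coeff n = fps_nth (fps_tan 1) n * fact n"

lemma tan_coeff_0 [simp]: "tan_coeff 0 = 0"
  by (simp add: tan_coeff_def fps_tan_def fps_divide_unit)

lemma tan_coeff_Suc:
  "tan_coeff (Suc n) =
     of_bool (n = 0) + (\<Sum>k\<le>n. real (n choose k) * (tan_coeff k * tan_coeff (n - k)))"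
proof -
  have "real (Suc n) * fps_nth (fps_tan 1) (Suc n) =
      of_bool (n = 0) + (\<Sum>k\<le>n. fps_nth (fps_tan 1) k * fps_nth (fps_tan 1) (n - k))"
    using arg_cong[OF fps_tan_deriv_eq, of "\<lambda>f. fps_nth f n"]
    by (simp add: power2_eq_square fps_mult_nth atLeast0AtMost)
  then have "tan_coeff (Suc n) = fact n *
      (of_bool (n = 0) + (\<Sum>k\<le>n. fps_nth (fps_tan 1) k * fps_nth (fps_tan 1) (n - k)))"
    unfolding tan_coeff_def by (metis (no_types, lifting) fact_Suc mult.assoc mult.commute)
  also have "\<dots> = of_bool (n = 0) +
      (\<Sum>k\<le>n. real (n choose k) * (tan_coeff k * tan_coeff (n - k)))"
  proof -
    have "fact n * (fps_nth (fps_tan 1) k * fps_nth (fps_tan 1) (n - k)) =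
        real (n choose k) * (tan_coeff k * tan_coeff (n - k))" if "k \<le> n" for k
      using binomial_fact_lemma[OF that, THEN arg_cong[of _ _ real]]
      unfolding tan_coeff_def by (simp add: mult_ac flip: of_nat_mult) 
        (metis (no_types, lifting) mult.assoc mult.commute of_nat_fact of_nat_mult)
    then show ?thesis
      by (cases "n = 0") (simp_all add: distrib_left sum_distrib_left)
  qed
  finally show ?thesis .
qed

text \<open>
  The sparse diagonal sets of extensions of \<open>q\<close> whose meet closure occupies exactly the levels in
  \<open>S\<close>. The sparseness condition forbids a bit 1 above \<open>q\<close> except directly after an element of
  the meet closure; for \<open>q = []\<close> and \<open>S = {..N}\<close> this amounts to \<^const>\<open>sparse_set\<close>. In
  this form it passes on to the two parts above the successors of the root, although those occupy only
  some of the levels. Keeping the stem \<open>q\<close> as a parameter spares the removal of the bit 1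
  that leads from the root to its right successor.
\<close>

definition sparse_diagonals :: "bseq \<Rightarrow> nat set \<Rightarrow> bseq set set" where
  "sparse_diagonals q S =
     {L. L \<noteq> {} \<and> prefix_antichain L \<and> transverse (meet_closure L) \<and>
         length ` meet_closure L = S \<and>
         (\<forall>t\<in>L. prefix q t \<and>
            (\<forall>n. length q \<le> n \<and> n < length t \<and> t ! n \<longrightarrow> take n t \<in> meet_closure L))}"

lemma finite_sparse_diagonals:
  assumes "finite S"
  shows "finite (sparse_diagonals q S)"
proof (rule finite_subset)
  show "sparse_diagonals q S \<subseteq> Pow {t. length t \<le> Max S}"
  proof (intro subsetI PowI CollectI)
    fix L t assume "L \<in> sparse_diagonals q S" "t \<in> L"
    then have "length t \<in> S"
      unfolding sparse_diagonals_def using subset_meet_closure by blast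
    then show "length t \<le> Max S"
      using assms by simp
  qed
  show "finite (Pow {t :: bseq. length t \<le> Max S})"
    using finite_lists_length_le[of "UNIV :: bool set" "Max S"] by simp
qed

lemma sparse_diagonals_empty [simp]: "sparse_diagonals q {} = {}"
  unfolding sparse_diagonals_def using subset_meet_closure by blast

text \<open>
  Below its root a sparse diagonal set has no meets, so that it cannot use the bit 1 between
  the stem and the root: the root is determined by \<open>q\<close> and \<open>S\<close>.
\<close>

lemma sparse_diagonal_root:
  assumes "L \<in> sparse_diagonals q S" "finite S"
    and r: "r \<in> meet_closure L" "\<And>t. t \<in> L \<Longrightarrow> prefix r t"
  shows "r = q @ replicate (Min S - length q) False"
proof -
  have L: "L \<noteq> {}" "length ` meet_closure L = S" "\<And>t. t \<in> L \<Longrightarrow> prefix q t"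
    and sparse: "\<And>t n. t \<in> L \<Longrightarrow> length q \<le> n \<Longrightarrow> n < length t \<Longrightarrow> t ! n \<Longrightarrow>
      take n t \<in> meet_closure L"
    using assms(1) unfolding sparse_diagonals_def by blast+
  have min: "Min S = length r"
  proof (rule Min_eqI)
    show "length r \<le> n" if "n \<in> S" for n
      using that L(2) prefix_meet_closure[OF r(2)] prefix_length_le by blast
  qed (use assms(2) L(2) r(1) in auto)
  obtain zs where zs: "r = q @ zs"
    using prefix_meet_closure[OF L(3) r(1)] unfolding prefix_def by blast
  have "zs = replicate (length zs) False"
  proof (rule replicate_length_same[symmetric], intro ballI)
    fix b assume "b \<in> set zs"
    then obtain i where i: "i < length zs" "zs ! i = b"
      by (auto simp: in_set_conv_nth)
    show "b = False"
    proof (rule ccontr)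
      assume "b \<noteq> False"
      obtain t where "t \<in> L"
        using L(1) by blast
      then obtain ys where t: "t = r @ ys"
        using r(2) unfolding prefix_def by blast
      let ?n = "length q + i"
      have "t ! ?n"
        using i \<open>b \<noteq> False\<close> unfolding t zs by (simp add: nth_append)
      then have "take ?n t \<in> meet_closure L"
        using sparse[OF \<open>t \<in> L\<close>, of ?n] i(1) t zs by simp
      moreover have "length (take ?n t) = ?n" "?n < length r"
        using i unfolding t zs by auto
      ultimately show False
        using min assms(2) L(2) Min_le[of S ?n] by (metis image_eqI leD)
    qed
  qed
  then show ?thesis
    unfolding min zs by simp
qed

text \<open>
  The recursion. A sparse diagonal set is either the singleton of its root or the union of its parts
  above the two successors of the root, which share out the remaining levels \<open>R\<close>.
\<close>

lemma sparse_diagonals_subset: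
  fixes q S
  assumes "finite S" "S \<noteq> {}"
  defines "p \<equiv> q @ replicate (Min S - length q) False" and "R \<equiv> S - {Min S}"
  shows "sparse_diagonals q S \<subseteq> (if R = {} then {{p}} else {}) \<union>
    (\<Union>A\<in>Pow R. (\<lambda>(X, Y). X \<union> Y) `
      (sparse_diagonals (p @ [False]) A \<times> sparse_diagonals (p @ [True]) (R - A)))"
    (is "_ \<subseteq> ?single \<union> ?split")
proof
  fix L assume L: "L \<in> sparse_diagonals q S"
  then have anti: "prefix_antichain L" and trans: "transverse (meet_closure L)"
    and ne: "L \<noteq> {}" and S: "length ` meet_closure L = S" 
    and sparse: "\<And>t n. t \<in> L \<Longrightarrow> length q \<le> n \<Longrightarrow> n < length t \<Longrightarrow> t ! n \<Longrightarrow>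
      take n t \<in> meet_closure L"
    unfolding sparse_diagonals_def by blast+
  show "L \<in> ?single \<union> ?split"
  proof (cases "\<exists>t. L = {t}")
    case True
    then obtain t where t: "L = {t}" ..
    then have "t = p"
      unfolding p_def using sparse_diagonal_root[OF L assms(1), of t] by simp
    moreover have "R = {}"
      using S unfolding t R_def by auto
    ultimately show ?thesis
      using t by simp
  next
    case False
    then obtain s t where "s \<in> L" "t \<in> L" "s \<noteq> t"
      using ne by (metis is_singletonI' is_singleton_def)
    then obtain r where snoc: "\<And>u. u \<in> L \<Longrightarrow> \<exists>b. prefix (r @ [b]) u"
      and nonempty: "\<And>b. above (r @ [b]) L \<noteq> {}"
      using antichain_branches anti by metis
    note mc = meet_closure_branches[OF snoc nonempty]
    have "prefix r u" if "u \<in> L" for u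
      using snoc[OF that] append_prefixD by blast
    then have "r = p"
      unfolding p_def using sparse_diagonal_root[OF L assms(1)] mc by blast
    have inj: "inj_on length (meet_closure L)"
      using trans unfolding transverse_def inj_on_def by blast
    let ?L = "\<lambda>b. above (p @ [b]) L"
    let ?S = "\<lambda>b. length ` meet_closure (?L b)"
    have mcb: "meet_closure (?L b) \<subseteq> meet_closure L" for b
      by (rule meet_closure_mono[OF above_subset])
    have part: "?L b \<in> sparse_diagonals (p @ [b]) (?S b)" for b
    proof -
      have "take n t \<in> meet_closure (?L b)"
        if t: "t \<in> ?L b" and n: "length (p @ [b]) \<le> n" "n < length t" "t ! n" for n t
      proof -
        have "length q \<le> n"
          using n(1) unfolding p_def by simp
        moreover have "t \<in> L" "prefix (p @ [b]) t"
          using t unfolding above_def by auto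
        ultimately have "take n t \<in> meet_closure L"
          using sparse n by blast
        moreover have "prefix (p @ [b]) (take n t)"
          by (rule prefix_length_prefix[OF \<open>prefix (p @ [b]) t\<close> take_is_prefix]) (use n(1,2) in simp)
        then have "take n t \<noteq> p" "take n t \<notin> meet_closure (?L (\<not> b))"
          using prefix_snoc_unique[of p b "take n t" "\<not> b"]
            prefix_meet_closure_above[of "take n t" "p @ [\<not> b]" L] by auto
        ultimately show ?thesis
          using mc unfolding \<open>r = p\<close> by (cases b) auto
      qed
      moreover have "transverse (meet_closure (?L b))"
        using trans mcb unfolding transverse_def by blast
      moreover have "\<forall>t\<in>?L b. prefix (p @ [b]) t"
        unfolding above_def by blast
      ultimately show ?thesis
        using nonempty prefix_antichain_subset[OF anti above_subset]
        unfolding sparse_diagonals_def \<open>r = p\<close> by blast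
    qed
    have "Min S = length p"
    proof (rule Min_eqI)
      show "length p \<le> n" if "n \<in> S" for n
        using that prefix_meet_closure[of L p] \<open>\<And>u. u \<in> L \<Longrightarrow> prefix r u\<close> prefix_length_le
        unfolding S[symmetric] \<open>r = p\<close> by blast
    qed (use assms(1) S mc \<open>r = p\<close> in auto)
    moreover have "?S False \<inter> ?S True = {}"
      using inj_on_image_Int[OF inj mcb mcb] meet_closure_above_disjoint(1) by (metis image_empty)
    moreover have "length p \<notin> ?S b" for b
      using prefix_meet_closure_above[of _ "p @ [b]" L] prefix_length_le by fastforce
    moreover have "S = insert (length p) (?S False \<union> ?S True)"
      using S mc unfolding \<open>r = p\<close> by auto
    ultimately have S_True: "?S True = R - ?S False" and S_False: "?S False \<in> Pow R"
      unfolding R_def by auto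
    have "L = ?L False \<union> ?L True"
      using Un_above[OF snoc] unfolding \<open>r = p\<close> .
    moreover have "(?L False, ?L True) \<in>
        sparse_diagonals (p @ [False]) (?S False) \<times> sparse_diagonals (p @ [True]) (R - ?S False)"
      using part[of False] part[of True] unfolding S_True by (rule SigmaI)
    ultimately have "L \<in> (\<lambda>(X, Y). X \<union> Y) `
        (sparse_diagonals (p @ [False]) (?S False) \<times> sparse_diagonals (p @ [True]) (R - ?S False))"
      by (intro image_eqI[of _ _ "(?L False, ?L True)"]) simp_all
    then have "L \<in> ?split"
      by (rule UN_I[OF S_False])
    then show ?thesis
      by (rule UnI2)
  qed
qed

lemma sum_Pow_card:
  fixes g :: "nat \<Rightarrow> real"
  assumes "finite A"
  shows "(\<Sum>X\<in>Pow A. g (card X)) = (\<Sum>k\<le>card A. real (card A choose k) * g k)"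
proof -
  have "(\<Sum>X\<in>Pow A. g (card X)) = (\<Sum>k\<le>card A. \<Sum>X\<in>{X \<in> Pow A. card X = k}. g (card X))"
    using assms by (intro sum.group[symmetric]) (auto intro: card_mono)
  also have "\<dots> = (\<Sum>k\<le>card A. real (card {X. X \<subseteq> A \<and> card X = k}) * g k)"
    by (intro sum.cong) auto
  finally show ?thesis
    using n_subsets[OF assms] by simp
qed

text \<open>
  Bounding the union in \<open>sparse_diagonals_subset\<close> term by term gives the recursion of
  \<open>tan_coeff_Suc\<close>: the level set \<open>A\<close> of the left part ranges over the subsets of \<open>R\<close>.
\<close>

lemma card_sparse_diagonals_le:
  assumes "finite S"
  shows "real (card (sparse_diagonals q S)) \<le> tan_coeff (card S)"
  using assms
proof (induction "card S" arbitrary: q S rule: less_induct)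
  case less
  show ?case
  proof (cases "S = {}")
    case True
    then show ?thesis
      by simp
  next
    case False
    let ?D = sparse_diagonals
    define p where "p = q @ replicate (Min S - length q) False"
    define R where "R = S - {Min S}"
    have fin: "finite R"
      using less.prems unfolding R_def by simp
    have cardS: "card S = Suc (card R)"
      unfolding R_def using less.prems False by (intro card.remove) auto
    have finA: "finite A" "finite (R - A)" if "A \<in> Pow R" for A
      using that fin finite_subset by auto
    let ?P = "\<lambda>A. ?D (p @ [False]) A \<times> ?D (p @ [True]) (R - A)"
    let ?single = "if R = {} then {{p}} else {}"
    let ?split = "\<Union>A\<in>Pow R. (\<lambda>(X, Y). X \<union> Y) ` ?P A"
    have finP: "finite (?P A)" if "A \<in> Pow R" for A
      using finA[OF that] finite_sparse_diagonals by blast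
    have "card (?D q S) \<le> card (?single \<union> ?split)"
      using sparse_diagonals_subset[OF less.prems False, of q] finP fin
      unfolding p_def[symmetric] R_def[symmetric] by (intro card_mono) auto
    also have "\<dots> \<le> card ?single + card ?split"
      by (rule card_Un_le)
    also have "card ?split \<le> (\<Sum>A\<in>Pow R. card ((\<lambda>(X, Y). X \<union> Y) ` ?P A))"
      using fin by (intro card_UN_le) simp
    also have "\<dots> \<le> (\<Sum>A\<in>Pow R. card (?P A))"
      using finP by (intro sum_mono card_image_le)
    finally have "card (?D q S) \<le> card ?single + (\<Sum>A\<in>Pow R. card (?P A))"
      by simp
    then have "real (card (?D q S)) \<le> real (card ?single + (\<Sum>A\<in>Pow R. card (?P A)))"
      by (rule of_nat_mono)
    also have "\<dots> = real (card ?single) + (\<Sum>A\<in>Pow R. real (card (?P A)))"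
      by (simp only: of_nat_add of_nat_sum)
    also have "(\<Sum>A\<in>Pow R. real (card (?P A))) \<le>
        (\<Sum>A\<in>Pow R. tan_coeff (card A) * tan_coeff (card R - card A))"
    proof (rule sum_mono)
      fix A assume A: "A \<in> Pow R"
      then have le: "card A \<le> card R" "card (R - A) = card R - card A"
        using fin by (auto simp: card_mono card_Diff_subset finite_subset)
      have "real (card (?D (p @ [False]) A)) \<le> tan_coeff (card A)"
        using less.hyps le cardS finA[OF A] by simp
      moreover have "real (card (?D (p @ [True]) (R - A))) \<le> tan_coeff (card R - card A)"
        using less.hyps[of "R - A"] le cardS finA[OF A] by simp
      ultimately show "real (card (?P A)) \<le> tan_coeff (card A) * tan_coeff (card R - card A)"
        unfolding card_cartesian_product of_nat_mult
        by (meson mult_mono of_nat_0_le_iff order_trans)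
    qed
    also have "\<dots> = (\<Sum>k\<le>card R. real (card R choose k) * (tan_coeff k * tan_coeff (card R - k)))"
      using sum_Pow_card[OF fin, of "\<lambda>k. tan_coeff k * tan_coeff (card R - k)"] .
    also have "real (card ?single) + \<dots> = tan_coeff (card S)"
      unfolding cardS tan_coeff_Suc using fin by simp
    finally show ?thesis
      by simp
  qed
qed

section \<open>Linear orders of a finite set with a prescribed least element\<close>

definition strict_linear_orders :: "'a set \<Rightarrow> 'a rel set" where
  "strict_linear_orders A = {r. r \<subseteq> A \<times> A \<and> strict_linear_order_on A r}"

definition strict_linear_orders_from :: "'a \<Rightarrow> 'a set \<Rightarrow> 'a rel set" where
  "strict_linear_orders_from d A = {r \<in> strict_linear_orders A. \<forall>u\<in>A - {d}. (d, u) \<in> r}"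

lemma Restr_strict_linear_orders:
  assumes "strict_linear_order_on A r" "B \<subseteq> A"
  shows "Restr r B \<in> strict_linear_orders B"
proof -
  have "total_on B r"
    using assms total_on_subset unfolding strict_linear_order_on_def by blast
  then have "total_on B (Restr r B)"
    unfolding total_on_def by blast
  moreover have "trans (Restr r B)" "irrefl (Restr r B)"
    using assms(1) unfolding strict_linear_order_on_def
    by (auto simp: trans_Restr irrefl_def)
  ultimately show ?thesis
    unfolding strict_linear_orders_def strict_linear_order_on_def by blast
qed

lemma finite_strict_linear_orders:
  assumes "finite A"
  shows "finite (strict_linear_orders A)" "finite (strict_linear_orders_from d A)"
proof -
  have "strict_linear_orders A \<subseteq> Pow (A \<times> A)"
    unfolding strict_linear_orders_def by blast
  then show "finite (strict_linear_orders A)"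
    using assms by (meson finite_Pow_iff finite_SigmaI finite_subset)
  then show "finite (strict_linear_orders_from d A)"
    unfolding strict_linear_orders_from_def by simp
qed

lemma card_strict_linear_orders_from_le:
  assumes "finite A"
  shows "card (strict_linear_orders_from d A) \<le> card (strict_linear_orders (A - {d}))"
proof (rule card_inj_on_le)
  have eq: "r = Restr r (A - {d}) \<union> {d} \<times> (A - {d})"
    if "r \<in> strict_linear_orders_from d A" for r
  proof -
    have "r \<subseteq> A \<times> A" "trans r" "irrefl r" "\<forall>u\<in>A - {d}. (d, u) \<in> r"
      using that unfolding strict_linear_orders_from_def strict_linear_orders_def
        strict_linear_order_on_def by auto
    then show ?thesis
      unfolding irrefl_def by (auto dest: transD)
  qed
  show "inj_on (\<lambda>r. Restr r (A - {d})) (strict_linear_orders_from d A)"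
    by (rule inj_onI) (metis eq)
  show "(\<lambda>r. Restr r (A - {d})) ` strict_linear_orders_from d A \<subseteq> strict_linear_orders (A - {d})"
    using Restr_strict_linear_orders[of A _ "A - {d}"]
    unfolding strict_linear_orders_from_def strict_linear_orders_def[of A] by auto
qed (use assms finite_strict_linear_orders in auto)

lemma strict_linear_order_least:
  assumes "finite A" "A \<noteq> {}" "r \<in> strict_linear_orders A"
  obtains d where "d \<in> A" "r \<in> strict_linear_orders_from d A"
proof -
  have r: "r \<subseteq> A \<times> A" "trans r" "irrefl r" "total_on A r"
    using assms(3) unfolding strict_linear_orders_def strict_linear_order_on_def by auto
  have "finite r"
    using r(1) assms(1) by (meson finite_SigmaI finite_subset)
  moreover have "acyclic r"
    using r by (simp add: acyclic_irrefl)
  ultimately have "wf r"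
    by (rule finite_acyclic_wf)
  then obtain d where d: "d \<in> A" "\<And>u. (u, d) \<in> r \<Longrightarrow> u \<notin> A"
    using assms(2) by (metis ex_in_conv wfE_min)
  then have "\<forall>u\<in>A - {d}. (d, u) \<in> r"
    using r(4) unfolding total_on_def by blast
  then show ?thesis
    using that d(1) assms(3) unfolding strict_linear_orders_from_def by blast
qed

lemma card_strict_linear_orders_le:
  assumes "finite A"
  shows "card (strict_linear_orders A) \<le> fact (card A)"
  using assms
proof (induction "card A" arbitrary: A)
  case 0
  then have "strict_linear_orders A \<subseteq> {{}}"
    unfolding strict_linear_orders_def by auto
  then have "card (strict_linear_orders A) \<le> card {{} :: 'a rel}"
    by (intro card_mono) auto
  then show ?case
    using 0 by simp
next
  case (Suc n)
  have ne: "A \<noteq> {}"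
    using Suc.hyps(2) by auto
  have "strict_linear_orders A \<subseteq> (\<Union>d\<in>A. strict_linear_orders_from d A)"
    using strict_linear_order_least[OF Suc.prems ne] by blast
  then have "card (strict_linear_orders A) \<le> card (\<Union>d\<in>A. strict_linear_orders_from d A)"
    using Suc.prems finite_strict_linear_orders by (intro card_mono) auto
  also have "\<dots> \<le> (\<Sum>d\<in>A. card (strict_linear_orders_from d A))"
    using Suc.prems by (rule card_UN_le)
  also have "\<dots> \<le> (\<Sum>d\<in>A. fact n)"
  proof (rule sum_mono)
    fix d assume "d \<in> A"
    then have n: "n = card (A - {d})"
      using Suc.hyps(2) Suc.prems by simp
    then have "card (strict_linear_orders (A - {d})) \<le> fact n"
      using Suc.hyps(1)[OF n] Suc.prems by simp
    then show "card (strict_linear_orders_from d A) \<le> fact n"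
      using card_strict_linear_orders_from_le[OF Suc.prems, of d] by linarith
  qed
  also have "\<dots> = fact (card A)"
    using Suc.hyps(2)[symmetric] by simp
  finally show ?case .
qed

lemma card_strict_linear_orders_from_le_fact:
  assumes "finite A" "d \<in> A"
  shows "card (strict_linear_orders_from d A) \<le> fact (card A - 1)"
  using card_strict_linear_orders_from_le[OF assms(1), of d]
    card_strict_linear_orders_le[of "A - {d}"] assms by simp

section \<open>Level sizes\<close>

lemma transverseD:
  "transverse A \<Longrightarrow> s \<in> A \<Longrightarrow> t \<in> A \<Longrightarrow> length s = length t \<Longrightarrow> s = t"
  unfolding transverse_def by blast

lemma leaf_extension:
  assumes "finite T" "t \<in> T"
  obtains l where "l \<in> leaves T" "prefix t l"
proof -
  let ?U = "{u \<in> T. prefix t u}"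
  have "finite ?U" "?U \<noteq> {}"
    using assms by auto
  then have "Max (length ` ?U) \<in> length ` ?U"
    by (intro Max_in) auto
  then obtain l where l: "l \<in> ?U" "length l = Max (length ` ?U)"
    by auto
  have "length u \<le> length l" if "u \<in> ?U" for u
    using that \<open>finite ?U\<close> unfolding l(2) by simp
  then have "\<not> strict_prefix l u" if "u \<in> T" for u
    using that l(1) prefix_length_less[of l u] prefix_order.trans[of t l u]
    by (metis (mono_tags, lifting) leD mem_Collect_eq strict_prefixE)
  then show ?thesis
    using that l(1) unfolding leaves_def by blast
qed

lemma tree_eq_prefixes_of_leaves:
  assumes "finite T" "prefix_closed T"
  shows "T = {s. \<exists>l\<in>leaves T. prefix s l}"
proof
  show "T \<subseteq> {s. \<exists>l\<in>leaves T. prefix s l}"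
  proof
    fix s assume "s \<in> T"
    then obtain l where "l \<in> leaves T" "prefix s l"
      by (rule leaf_extension[OF assms(1)])
    then show "s \<in> {s. \<exists>l\<in>leaves T. prefix s l}"
      by blast
  qed
  show "{s. \<exists>l\<in>leaves T. prefix s l} \<subseteq> T"
    using assms(2) unfolding prefix_closed_def leaves_def by blast
qed

text \<open>
  A node with two successors in the tree is the meet of two leaves, one above each successor; a
  transverse meet closure therefore leaves room for one such node per level.
\<close>

lemma card_level_Suc_le:
  assumes "finite T" "prefix_closed T" "transverse (meet_closure (leaves T))"
  shows "card (level T (Suc n)) \<le> card (level T n) + 1"
proof -
  let ?C = "\<lambda>b. {u. length u = n \<and> u @ [b] \<in> T}"
  have C: "?C b \<subseteq> level T n" for b
    using assms(2) unfolding level_def prefix_closed_def by auto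
  have fin: "finite (level T n)"
    using assms(1) unfolding level_def by simp
  then have finC: "finite (?C b)" for b
    using C finite_subset by blast
  have "level T (Suc n) \<subseteq> (\<lambda>u. u @ [False]) ` ?C False \<union> (\<lambda>u. u @ [True]) ` ?C True"
  proof
    fix t assume "t \<in> level T (Suc n)"
    then obtain u b where "t = u @ [b]" "length u = n" "t \<in> T"
      unfolding level_def by (metis (mono_tags, lifting) length_Suc_conv_rev mem_Collect_eq)
    then show "t \<in> (\<lambda>u. u @ [False]) ` ?C False \<union> (\<lambda>u. u @ [True]) ` ?C True"
      by (cases b) auto
  qed
  then have "card (level T (Suc n)) \<le>
      card ((\<lambda>u. u @ [False]) ` ?C False \<union> (\<lambda>u. u @ [True]) ` ?C True)"
    using finC by (intro card_mono) auto
  also have "\<dots> \<le> card ((\<lambda>u. u @ [False]) ` ?C False) + card ((\<lambda>u. u @ [True]) ` ?C True)"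
    by (rule card_Un_le)
  also have "\<dots> \<le> card (?C False) + card (?C True)"
    using finC by (intro add_mono card_image_le)
  also have "\<dots> = card (?C False \<union> ?C True) + card (?C False \<inter> ?C True)"
    by (rule card_Un_Int[OF finC finC])
  also have "card (?C False \<union> ?C True) \<le> card (level T n)"
    using C fin by (intro card_mono) auto
  also have "card (?C False \<inter> ?C True) \<le> 1"
  proof -
    have meet: "u \<in> meet_closure (leaves T)" if u: "u \<in> ?C False \<inter> ?C True" for u
    proof -
      have "u @ [False] \<in> T" "u @ [True] \<in> T"
        using u by auto
      obtain s where s: "s \<in> leaves T" "prefix (u @ [False]) s"
        using leaf_extension[OF assms(1) \<open>u @ [False] \<in> T\<close>] .
      obtain t where t: "t \<in> leaves T" "prefix (u @ [True]) t"
        using leaf_extension[OF assms(1) \<open>u @ [True] \<in> T\<close>] .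
      have "u = longest_common_prefix s t"
        using longest_common_prefix_diverge[OF _ s(2) t(2)] by simp
      then show ?thesis
        unfolding meet_closure_def using s(1) t(1) by blast
    qed
    have "u = v" if "u \<in> ?C False \<inter> ?C True" "v \<in> ?C False \<inter> ?C True" for u v
      using that by (intro transverseD[OF assms(3) meet meet]) auto
    then show ?thesis
      using finC by (simp add: card_le_Suc0_iff_eq)
  qed
  finally show ?thesis
    by simp
qed

text \<open>
  Only leaves have no successor, and each level contains at most one leaf.
\<close>

lemma card_level_le_Suc:
  assumes "finite T" "prefix_closed T" "transverse (meet_closure (leaves T))"
  shows "card (level T n) \<le> card (level T (Suc n)) + 1"
proof -
  let ?E = "level T n \<inter> leaves T"
  have fin: "finite (level T k)" for k
    using assms(1) unfolding level_def by simp
  have "level T n \<subseteq> ?E \<union> take n ` level T (Suc n)"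
  proof
    fix t assume t: "t \<in> level T n"
    show "t \<in> ?E \<union> take n ` level T (Suc n)"
    proof (cases "t \<in> leaves T")
      case False
      then obtain s where s: "s \<in> T" "strict_prefix t s"
        using t unfolding leaves_def level_def by blast
      then obtain zs where zs: "s = t @ zs" "zs \<noteq> []"
        unfolding strict_prefix_def prefix_def by auto
      have "length t = n"
        using t unfolding level_def by simp
      have "length (take (Suc n) s) = Suc n" "take n (take (Suc n) s) = t"
        using zs \<open>length t = n\<close> by (cases zs; simp)+
      moreover have "take (Suc n) s \<in> T"
        using s(1) assms(2) take_is_prefix unfolding prefix_closed_def by blast
      ultimately show ?thesis
        unfolding level_def by (metis (mono_tags, lifting) UnI2 image_eqI mem_Collect_eq)
    qed (use t in simp)
  qed
  then have "card (level T n) \<le> card (?E \<union> take n ` level T (Suc n))"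
    using fin by (intro card_mono) auto
  also have "\<dots> \<le> card ?E + card (take n ` level T (Suc n))"
    by (rule card_Un_le)
  also have "card (take n ` level T (Suc n)) \<le> card (level T (Suc n))"
    using fin by (rule card_image_le)
  also have "card ?E \<le> 1"
  proof -
    have "u = v" if "u \<in> ?E" "v \<in> ?E" for u v
      using that subset_meet_closure[of "leaves T"]
      by (intro transverseD[OF assms(3)]) (auto simp: level_def)
    then show ?thesis
      using fin by (simp add: card_le_Suc0_iff_eq)
  qed
  finally show ?thesis
    by simp
qed

section \<open>Counting types and vip orders\<close>

text \<open>
  The \<open>2 * m - 1\<close> elements of the meet closure have distinct lengths, all of them at most
  \<open>2 * m - 2\<close>, so every level up to there is occupied. Where a leaf has a bit 1, the element of the
  meet closure on that level is by \<^const>\<open>sparse_set\<close> an initial segment of the leaf.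
\<close>

lemma sparse_type_facts:
  assumes "sparse_type m T" "m \<ge> 1"
  shows "finite T" "prefix_closed T" "transverse (meet_closure (leaves T))"
    and "leaves T \<in> sparse_diagonals [] {..2 * m - 2}"
proof -
  let ?L = "leaves T"
  have T: "T \<subseteq> {s. length s \<le> 2 * m - 2}" and closed: "prefix_closed T"
    and L: "finite ?L" "card ?L = m"
    and diag: "diagonal_set ?L" and sparse: "sparse_set ?L"
    using assms(1) unfolding sparse_type_def by auto
  show "finite T"
    using T finite_lists_length_le[of "UNIV :: bool set" "2 * m - 2"] finite_subset by auto
  show "prefix_closed T"
    by (rule closed)
  show trans: "transverse (meet_closure ?L)"
    using diag unfolding diagonal_set_def by blast
  have anti: "prefix_antichain ?L"
    using diag unfolding diagonal_set_def prefix_antichain_def by blast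
  have ne: "?L \<noteq> {}"
    using L(2) assms(2) by auto
  have "length t \<le> 2 * m - 2" if "t \<in> meet_closure ?L" for t
  proof -
    obtain s where "s \<in> ?L" "prefix t s"
      using \<open>t \<in> meet_closure ?L\<close> longest_common_prefix_prefix1 unfolding meet_closure_def by blast
    then show ?thesis
      using T prefix_length_le unfolding leaves_def by force
  qed
  then have "length ` meet_closure ?L \<subseteq> {..2 * m - 2}"
    by blast
  moreover have "inj_on length (meet_closure ?L)"
    using trans unfolding transverse_def inj_on_def by blast
  then have "card (length ` meet_closure ?L) = card {..2 * m - 2}"
    using card_meet_closure[OF L(1) ne anti] L(2) assms(2) by (simp add: card_image) arith
  ultimately have lengths: "length ` meet_closure ?L = {..2 * m - 2}"
    by (intro card_subset_eq) auto
  have "take n t \<in> meet_closure ?L" if t: "t \<in> ?L" "n < length t" "t ! n" for n t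
  proof -
    have "n \<in> {..2 * m - 2}"
      using t T unfolding leaves_def by force
    then obtain s where s: "s \<in> meet_closure ?L" "n = length s"
      unfolding lengths[symmetric] by blast
    then have "prefix s t"
      using t sparse unfolding sparse_set_def by blast
    then have "take n t = s"
      using s(2) by (auto simp: prefix_def)
    then show ?thesis
      using s(1) by simp
  qed
  then show "?L \<in> sparse_diagonals [] {..2 * m - 2}"
    using ne anti trans lengths unfolding sparse_diagonals_def by simp
qed

lemma card_sparse_types_le:
  assumes "m \<ge> 1"
  shows "real (card {T. sparse_type m T}) \<le> tangent_number m"
proof -
  have "inj_on leaves {T. sparse_type m T}"
  proof (rule inj_onI)
    fix T T' assume T: "T \<in> {T. sparse_type m T}" "T' \<in> {T. sparse_type m T}" "leaves T = leaves T'"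
    have "T = {s. \<exists>l\<in>leaves T. prefix s l}"
      using T(1) assms by (intro tree_eq_prefixes_of_leaves sparse_type_facts(1,2)) auto
    also have "\<dots> = T'"
      unfolding T(3) using T(2) assms
      by (intro tree_eq_prefixes_of_leaves[symmetric] sparse_type_facts(1,2)) auto
    finally show "T = T'" .
  qed
  then have "card {T. sparse_type m T} \<le> card (sparse_diagonals [] {..2 * m - 2})"
    using sparse_type_facts(4)[OF _ assms] finite_sparse_diagonals
    by (intro card_inj_on_le) auto
  then have "real (card {T. sparse_type m T}) \<le> tan_coeff (card {..2 * m - 2})"
    using card_sparse_diagonals_le[of "{..2 * m - 2}" "[]"] by simp
  also have "card {..2 * m - 2} = 2 * m - 1"
    using assms by simp
  finally show ?thesis
    unfolding tan_coeff_def tangent_number_def .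
qed

text \<open>
  Count upwards from the root level, and downwards from the empty level \<open>2 * m - 1\<close>.
\<close>

lemma card_level_le:
  assumes "sparse_type m T" "m \<ge> 1" "n \<le> 2 * m - 2"
  shows "card (level T n) \<le> min n (2 * m - 2 - n) + 1"
proof -
  note T = sparse_type_facts(1-3)[OF assms(1,2)]
  have "card (level T k) \<le> k + 1" for k
  proof (induction k)
    case 0
    have "level T 0 \<subseteq> {[]}"
      unfolding level_def by auto
    then show ?case
      using card_mono[of "{[]}" "level T 0"] by simp
  next
    case (Suc k)
    then show ?case
      using card_level_Suc_le[OF T, of k] by simp
  qed
  moreover have "card (level T n) \<le> card (level T (n + k)) + k" for k
  proof (induction k)
    case (Suc k)
    then show ?case
      using card_level_le_Suc[OF T, of "n + k"] by simp
  qed simp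
  from this[of "2 * m - 1 - n"] have "card (level T n) \<le> 2 * m - 1 - n"
  proof -
    have "level T (n + (2 * m - 1 - n)) = {}"
      using assms unfolding sparse_type_def level_def by auto
    then show ?thesis
      using \<open>card (level T n) \<le> card (level T (n + (2 * m - 1 - n))) + (2 * m - 1 - n)\<close> by simp
  qed
  ultimately show ?thesis
    using assms(2,3) by (auto simp: min_def)
qed

text \<open>
  Between different levels the order is that of the lengths. Applied in both directions, this shows
  that a well-ordering of the levels is determined by its restrictions to them.
\<close>

lemma level_well_ordering_subset:
  assumes "level_well_ordering T r" "level_well_ordering T r'"
    and restr: "\<And>t. t \<in> T \<Longrightarrow> Restr r (level T (length t)) = Restr r' (level T (length t))"
  shows "r \<subseteq> r'"
proof
  fix x assume "x \<in> r"
  then obtain s t where x: "x = (s, t)" "(s, t) \<in> r" "s \<in> T" "t \<in> T"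
    using assms(1) unfolding level_well_ordering_def by blast
  have "\<not> length t < length s"
  proof
    assume "length t < length s"
    then have "(t, s) \<in> r"
      using assms(1) x unfolding level_well_ordering_def by blast
    then show False
      using assms(1) x(2) unfolding level_well_ordering_def strict_linear_order_on_def
      by (meson irreflD transD)
  qed
  then consider "length s < length t" | "length s = length t"
    by linarith
  then show "x \<in> r'"
  proof cases
    case 1
    then show ?thesis
      using assms(2) x unfolding level_well_ordering_def by blast
  next
    case 2
    then have "x \<in> Restr r (level T (length t))"
      using x unfolding level_def by blast
    then show ?thesis
      using restr[OF x(4)] by blast
  qed
qed

text \<open>
  Restriction to the levels embeds the vip orders into the product, over the levels, of the linear
  orders whose least element is the element of the meet closure on that level.
\<close>

lemma card_vip_orders_le:
  assumes "sparse_type m T" "m \<ge> 1"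
  shows "card {r. vip_order (leaves T) T r} \<le> (\<Prod>n\<le>2 * m - 2. fact (min n (2 * m - 2 - n)))"
proof (cases "{r. vip_order (leaves T) T r} = {}")
  case False
  let ?V = "{r. vip_order (leaves T) T r}" and ?N = "2 * m - 2"
  obtain r0 where r0: "vip_order (leaves T) T r0"
    using False by blast
  have fin: "finite (level T n)" for n
    using sparse_type_facts(1)[OF assms] unfolding level_def by simp
  have "\<exists>d. d \<in> meet_closure (leaves T) \<and> length d = n" if "n \<le> ?N" for n
  proof -
    have "n \<in> length ` meet_closure (leaves T)"
      using that sparse_type_facts(4)[OF assms] unfolding sparse_diagonals_def by simp
    then show ?thesis
      by auto
  qed
  then obtain d where d: "\<And>n. n \<le> ?N \<Longrightarrow> d n \<in> meet_closure (leaves T) \<and> length (d n) = n"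
    by metis
  have d_level: "d n \<in> level T n" if "n \<le> ?N" for n
    using r0 d[OF that] unfolding vip_order_def by auto
  let ?O = "\<lambda>n. strict_linear_orders_from (d n) (level T n)"
  let ?f = "\<lambda>r. \<lambda>n\<in>{..?N}. Restr r (level T n)"
  have "inj_on ?f ?V"
  proof (rule inj_onI)
    fix r r' assume r: "r \<in> ?V" "r' \<in> ?V" "?f r = ?f r'"
    have "Restr r (level T (length t)) = Restr r' (level T (length t))" if "t \<in> T" for t
    proof -
      have "length t \<in> {..?N}"
        using that assms(1) unfolding sparse_type_def by auto
      then show ?thesis
        using fun_cong[OF r(3), of "length t"] by simp
    qed
    moreover have "level_well_ordering T r" "level_well_ordering T r'"
      using r(1,2) unfolding vip_order_def by auto
    ultimately show "r = r'"
      using level_well_ordering_subset[of T r r'] level_well_ordering_subset[of T r' r] by simp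
  qed
  moreover have "?f ` ?V \<subseteq> PiE {..?N} ?O"
  proof -
    have "Restr r (level T n) \<in> ?O n" if "r \<in> ?V" "n \<le> ?N" for r n
    proof -
      have lin: "strict_linear_order_on T r"
        using that(1) unfolding vip_order_def level_well_ordering_def by auto
      have "Restr r (level T n) \<in> strict_linear_orders (level T n)"
        by (rule Restr_strict_linear_orders[OF lin]) (auto simp: level_def)
      moreover have "\<forall>u\<in>level T n - {d n}. (d n, u) \<in> r"
        using that(1) d[OF that(2)] unfolding vip_order_def by auto
      ultimately show ?thesis
        using d_level[OF that(2)] unfolding strict_linear_orders_from_def by blast
    qed
    then show ?thesis
      by (auto simp: PiE_iff)
  qed
  moreover have "finite (PiE {..?N} ?O)"
    using fin by (intro finite_PiE) (auto intro: finite_strict_linear_orders)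
  ultimately have "card ?V \<le> card (PiE {..?N} ?O)"
    by (rule card_inj_on_le)
  also have "\<dots> = (\<Prod>n\<le>?N. card (?O n))"
    by (rule card_PiE) simp
  also have "\<dots> \<le> (\<Prod>n\<le>?N. fact (min n (?N - n)))"
  proof (intro prod_mono conjI)
    fix n assume "n \<in> {..?N}"
    then have n: "n \<le> ?N"
      by simp
    have "card (?O n) \<le> fact (card (level T n) - 1)"
      using fin d_level[OF n] by (rule card_strict_linear_orders_from_le_fact)
    also have "\<dots> \<le> fact (min n (?N - n))"
      using card_level_le[OF assms n] by (intro fact_mono) linarith
    finally show "card (?O n) \<le> fact (min n (?N - n))" .
  qed simp
  finally show ?thesis .
qed (simp only: card.empty)

lemma prod_fold_in_half:
  fixes f :: "nat \<Rightarrow> 'a :: comm_monoid_mult"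
  shows "(\<Prod>n\<le>2 * k. f (min n (2 * k - n))) = f k * (\<Prod>i<k. (f i)\<^sup>2)"
proof -
  have "{..2 * k} = insert k ({..<k} \<union> {k<..2 * k})"
    by auto
  then have "(\<Prod>n\<le>2 * k. f (min n (2 * k - n))) =
      f k * ((\<Prod>n<k. f (min n (2 * k - n))) * (\<Prod>n\<in>{k<..2 * k}. f (min n (2 * k - n))))"
    by (simp add: prod.union_disjoint Int_def)
  also have "(\<Prod>n<k. f (min n (2 * k - n))) = (\<Prod>i<k. f i)"
    by (intro prod.cong) auto
  also have "(\<Prod>n\<in>{k<..2 * k}. f (min n (2 * k - n))) = (\<Prod>i<k. f i)"
    by (rule prod.reindex_bij_witness[of _ "\<lambda>i. 2 * k - i" "\<lambda>n. 2 * k - n"]) auto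
  finally show ?thesis
    by (simp add: power2_eq_square prod.distrib)
qed

theorem lemma6p13:
  fixes m :: nat
  assumes "m \<ge> 2"
  shows "real (card (sparse_vip_types m)) \<le>
    tangent_number m * fact (m - 1) * (\<Prod>i<m - 1. (fact i)\<^sup>2)"
proof -
  let ?T = "{T. sparse_type m T}" and ?V = "\<lambda>T. {r. vip_order (leaves T) T r}"
  let ?B = "fact (m - 1) * (\<Prod>i<m - 1. (fact i)\<^sup>2) :: nat"
  have m: "m \<ge> 1"
    using assms by simp
  have "?T \<subseteq> Pow {s. length s \<le> 2 * m - 2}"
    unfolding sparse_type_def by blast
  moreover have "finite {s :: bseq. length s \<le> 2 * m - 2}"
    using finite_lists_length_le[of "UNIV :: bool set" "2 * m - 2"] by simp
  ultimately have finT: "finite ?T"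
    by (meson finite_Pow_iff finite_subset)
  have finV: "finite (?V T)" if "T \<in> ?T" for T
  proof (rule finite_subset)
    show "?V T \<subseteq> Pow (T \<times> T)"
      unfolding vip_order_def level_well_ordering_def by blast
    show "finite (Pow (T \<times> T))"
      using that sparse_type_facts(1)[OF _ m] by simp
  qed
  have "sparse_vip_types m = Sigma ?T ?V"
    unfolding sparse_vip_types_def by auto
  then have "card (sparse_vip_types m) = (\<Sum>T\<in>?T. card (?V T))"
    using finT finV by simp
  also have "\<dots> \<le> (\<Sum>T\<in>?T. ?B)"
  proof (rule sum_mono)
    fix T assume "T \<in> ?T"
    then have "card (?V T) \<le> (\<Prod>n\<le>2 * m - 2. fact (min n (2 * m - 2 - n)))"
      using card_vip_orders_le m by blast
    moreover have "2 * m - 2 = 2 * (m - 1)"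
      by simp
    ultimately show "card (?V T) \<le> ?B"
      using prod_fold_in_half[of fact "m - 1"] by metis
  qed
  finally have "card (sparse_vip_types m) \<le> card ?T * ?B"
    by simp
  then have "real (card (sparse_vip_types m)) \<le> real (card ?T * ?B)"
    by (rule of_nat_mono)
  also have "\<dots> = real (card ?T) * real ?B"
    by (rule of_nat_mult)
  also have "\<dots> \<le> tangent_number m * real ?B"
    using card_sparse_types_le[OF m] by (rule mult_right_mono) (rule of_nat_0_le_iff)
  finally show ?thesis
    by (simp add: mult.assoc)
qed

end
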